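(* Let $n\ge 1$, let $A_0,A_1,B_0,B_1\in\mathbb{R}^{n\times n}$, and let $H\in\mathbb{R}^{4n^2\times 4n^2}$ and the commutation matrix $T\in\mathbb{R}^{n^2\times n^2}$ be as defined in the context. Let $I=I_n\otimes I_n$ be the $n^2\times n^2$ identity matrix, and let $\mathbf{0}$ be the $n^2\times n^2$ zero matrix. Define the $3n^2\times 4n^2$ matrix $$M=\begin{bmatrix} I & \mathbf{0} & \mathbf{0} & \mathbf{0}\\ \mathbf{0} & \mathbf{0} & I & \mathbf{0}\\ \mathbf{0} & \mathbf{0} & \mathbf{0} & I\end{bmatrix}+\begin{bmatrix} \mathbf{0} & -I & \mathbf{0} & \mathbf{0}\\ \mathbf{0} & \mathbf{0} & -T & \mathbf{0}\\ \mathbf{0} & \mathbf{0} & \mathbf{0} & T\end{bmatrix}e^{H}.$$ Then the null space of $M$ has dimension at least $n^2$, and the $3n^2$ rows of $M$ are linearly dependent. Equivalently for the second assertion: the $3n^2$ scalar boundary conditions $$Z(0)-V(1)=0,\qquad X_0(0)-X_0^T(1)=0,\qquad X_1(0)+X_1^T(1)=0,$$ regarded as linear functionals of the initial data $(Z(0),V(0),X_0(0),X_1(0))$ of solutions of the linear system of matrix differential equations given in the context, are linearly dependent.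
   Context: For a matrix $A$, $\mathrm{vec}(A)$ is the column vector obtained by stacking the columns of $A$; $\otimes$ is the Kronecker product; $I_n$ is the $n\times n$ identity. $T\in\mathbb{R}^{n^2\times n^2}$ is the (symmetric) commutation matrix, determined by $\mathrm{vec}(A^T)=T\,\mathrm{vec}(A)$ for all $A\in\mathbb{R}^{n\times n}$. The linear system of matrix differential equations for $n\times n$ matrix functions $Z,V,X_0,X_1$ of $\tau$ is $$\dot Z=ZA_0+VA_1+X_0B_0+X_1B_1,\qquad \dot V=-A_1^TZ-A_0^TV-B_0^TX_0+B_1^TX_1,$$ $$\dot X_0=-\pi X_1,\qquad \dot X_1=Z+V+\pi X_0.$$ With $z=\mathrm{vec}(Z)$, $v=\mathrm{vec}(V)$, $x_0=\mathrm{vec}(X_0)$, $x_1=\mathrm{vec}(X_1)$, it reads $\frac{d}{d\tau}(z,v,x_0,x_1)^T=H\,(z,v,x_0,x_1)^T$, where $$H=\begin{bmatrix} A_0^T\otimes I_n & A_1^T\otimes I_n & B_0^T\otimes I_n & B_1^T\otimes I_n\\ -I_n\otimes A_1^T & -I_n\otimes A_0^T & -I_n\otimes B_0^T & I_n\otimes B_1^T\\ \mathbf{0} & \mathbf{0} & \mathbf{0} & -\pi I_n\otimes I_n\\ I_n\otimes I_n & I_n\otimes I_n & \pi I_n\otimes I_n & \mathbf{0}\end{bmatrix}.$$ Solutions satisfy $(z,v,x_0,x_1)^T(\tau)=e^{H\tau}(z,v,x_0,x_1)^T(0)$, so the listed boundary conditions are equivalent to $M\,(z(0),v(0),x_0(0),x_1(0))^T=0$.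 *)

theory Defs
  imports "HOL-Analysis.Analysis"
begin

text \<open>
  A vector of length \<open>n\<^sup>2\<close> is indexed by pairs. The first component of an index is the
  position of the block and the second one the position inside the block. Thus the
  component \<open>(j, i)\<close> of the stacked columns of \<open>A\<close> is entry \<open>i\<close> of column \<open>j\<close>.
  The Kronecker product and the block matrices below follow the same convention.
\<close>

definition vectorize :: "real^'n^'m \<Rightarrow> real^('n \<times> 'm)" where
  "vectorize A = (\<chi> p. A $ snd p $ fst p)"

definition kronecker :: "real^'b^'a \<Rightarrow> real^'d^'c \<Rightarrow> real^('b \<times> 'd)^('a \<times> 'c)"
    (infixl "\<otimes>\<^sub>K" 75) where
  "A \<otimes>\<^sub>K B = (\<chi> p q. A $ fst p $ fst q * B $ snd p $ snd q)"

lemma vectorize_matrix_mult: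
  fixes A :: "real^'m^'k" and X :: "real^'n^'m" and B :: "real^'l^'n"
  shows "vectorize (A ** X ** B) = (transpose B \<otimes>\<^sub>K A) *v vectorize X"
proof -
  have "(\<Sum>k\<in>UNIV. (\<Sum>l\<in>UNIV. A $ i $ l * X $ l $ k) * B $ k $ j)
      = (\<Sum>q\<in>UNIV. B $ fst q $ j * A $ i $ snd q * X $ snd q $ fst q)" for i j
    by (simp add: UNIV_Times_UNIV[symmetric] sum.cartesian_product' sum_distrib_left
        sum_distrib_right mult_ac del: UNIV_Times_UNIV)
  then show ?thesis
    by (simp add: vec_eq_iff vectorize_def kronecker_def transpose_def
        matrix_matrix_mult_def matrix_vector_mult_def)
qed

definition commutation_matrix :: "real^('n::finite \<times> 'n)^('n \<times> 'n)" where
  "commutation_matrix =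
     (THE T. \<forall>A :: real^'n^'n. vectorize (transpose A) = T *v vectorize A)"

lemma commutation_matrix_ex1:
  "\<exists>!T. \<forall>A :: real^'n^'n. vectorize (transpose A) = T *v vectorize A"
proof (rule ex1I[of _ "\<chi> p q. if q = prod.swap p then 1 else 0"])
  show "\<forall>A :: real^'n^'n. vectorize (transpose A)
      = (\<chi> p q. if q = prod.swap p then 1 else 0) *v vectorize A"
    by (simp add: vec_eq_iff vectorize_def transpose_def matrix_vector_mult_def
        if_distrib[of "\<lambda>x. x * _"] cong: if_cong)
next
  fix T :: "real^('n::finite \<times> 'n)^('n \<times> 'n)"
  assume T: "\<forall>A :: real^'n^'n. vectorize (transpose A) = T *v vectorize A"
  have "T *v x = (\<chi> p q. if q = prod.swap p then 1 else 0) *v x" for x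
  proof -
    define A :: "real^'n^'n" where "A = (\<chi> i j. x $ (j, i))"
    have "x = vectorize A"
      by (simp add: A_def vectorize_def vec_eq_iff)
    then have "T *v x = vectorize (transpose A)"
      using T by simp
    then show ?thesis
      by (simp add: A_def vec_eq_iff vectorize_def transpose_def matrix_vector_mult_def
          if_distrib[of "\<lambda>x. x * _"] cong: if_cong)
  qed
  then show "T = (\<chi> p q. if q = prod.swap p then 1 else 0)"
    by (simp add: matrix_eq)
qed

lemma vectorize_transpose:
  "vectorize (transpose A) = commutation_matrix *v vectorize (A :: real^'n^'n)"
  using theI'[OF commutation_matrix_ex1] unfolding commutation_matrix_def by blast

definition block_matrix :: "(real^'d^'c)^'b^'a \<Rightarrow> real^('b \<times> 'd)^('a \<times> 'c)" where
  "block_matrix B = (\<chi> p q. B $ fst p $ fst q $ snd p $ snd q)"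

lemma vector_4 [simp]:
  "(vector [w, x, y, z] :: ('a::zero)^4) $ 1 = w"
  "(vector [w, x, y, z] :: ('a::zero)^4) $ 2 = x"
  "(vector [w, x, y, z] :: ('a::zero)^4) $ 3 = y"
  "(vector [w, x, y, z] :: ('a::zero)^4) $ 4 = z"
  unfolding vector_def by simp_all

text \<open>
  The multiplication of the type \<open>real^'n^'n\<close> is componentwise, so neither its powers
  nor \<open>exp\<close> are the ones of matrices.
\<close>

definition matrix_power :: "real^'n^'n \<Rightarrow> nat \<Rightarrow> real^'n^'n" where
  "matrix_power A k = ((\<lambda>B. A ** B) ^^ k) (mat 1)"

definition matrix_exp :: "real^'n^'n \<Rightarrow> real^'n^'n" where
  "matrix_exp A = (\<Sum>k. (1 / fact k) *\<^sub>R matrix_power A k)"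

definition H_matrix ::
    "real^'n^'n \<Rightarrow> real^'n^'n \<Rightarrow> real^'n^'n \<Rightarrow> real^'n^'n
     \<Rightarrow> real^(4 \<times> 'n \<times> 'n)^(4 \<times> 'n \<times> 'n)" where
  "H_matrix A0 A1 B0 B1 =
     (let I = mat 1 :: real^'n^'n in block_matrix (vector [
       vector [transpose A0 \<otimes>\<^sub>K I, transpose A1 \<otimes>\<^sub>K I, transpose B0 \<otimes>\<^sub>K I, transpose B1 \<otimes>\<^sub>K I],
       vector [- (I \<otimes>\<^sub>K transpose A1), - (I \<otimes>\<^sub>K transpose A0),
               - (I \<otimes>\<^sub>K transpose B0), I \<otimes>\<^sub>K transpose B1],
       vector [0, 0, 0, - (pi *\<^sub>R (I \<otimes>\<^sub>K I))],
       vector [I \<otimes>\<^sub>K I, I \<otimes>\<^sub>K I, pi *\<^sub>R (I \<otimes>\<^sub>K I), 0]]))"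

definition M_matrix ::
    "real^'n^'n \<Rightarrow> real^'n^'n \<Rightarrow> real^'n^'n \<Rightarrow> real^'n^'n
     \<Rightarrow> real^(4 \<times> 'n \<times> 'n)^(3 \<times> 'n \<times> 'n)" where
  "M_matrix A0 A1 B0 B1 =
     (let I = (mat 1 :: real^'n^'n) \<otimes>\<^sub>K (mat 1 :: real^'n^'n);
          T = commutation_matrix :: real^('n \<times> 'n)^('n \<times> 'n)
      in block_matrix (vector [
           vector [I, 0, 0, 0],
           vector [0, 0, I, 0],
           vector [0, 0, 0, I]])
       + block_matrix (vector [
           vector [0, - I, 0, 0],
           vector [0, 0, - T, 0],
           vector [0, 0, 0, T]])
         ** matrix_exp (H_matrix A0 A1 B0 B1))"

definition solves_system ::
    "real^'n^'n \<Rightarrow> real^'n^'n \<Rightarrow> real^'n^'n \<Rightarrow> real^'n^'n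
     \<Rightarrow> (real \<Rightarrow> real^'n^'n) \<Rightarrow> (real \<Rightarrow> real^'n^'n)
     \<Rightarrow> (real \<Rightarrow> real^'n^'n) \<Rightarrow> (real \<Rightarrow> real^'n^'n) \<Rightarrow> bool" where
  "solves_system A0 A1 B0 B1 Z V X0 X1 \<longleftrightarrow> (\<forall>t\<in>{0..1}.
     (Z has_vector_derivative
        Z t ** A0 + V t ** A1 + X0 t ** B0 + X1 t ** B1) (at t within {0..1}) \<and>
     (V has_vector_derivative
        - (transpose A1 ** Z t) - transpose A0 ** V t
        - transpose B0 ** X0 t + transpose B1 ** X1 t) (at t within {0..1}) \<and>
     (X0 has_vector_derivative - (pi *\<^sub>R X1 t)) (at t within {0..1}) \<and>
     (X1 has_vector_derivative Z t + V t + pi *\<^sub>R X0 t) (at t within {0..1}))"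

definition boundary_residual ::
    "(real \<Rightarrow> real^'n^'n) \<Rightarrow> (real \<Rightarrow> real^'n^'n)
     \<Rightarrow> (real \<Rightarrow> real^'n^'n) \<Rightarrow> (real \<Rightarrow> real^'n^'n) \<Rightarrow> (real^'n^'n)^3" where
  "boundary_residual Z V X0 X1 =
     vector [Z 0 - V 1, X0 0 - transpose (X0 1), X1 0 + transpose (X1 1)]"

text \<open>
  Linear dependence of a finite family, as opposed to \<open>dependent\<close>, which is about the set
  of its members: a family with a repeated member is dependent, although its range need
  not be.
\<close>

definition dependent_family :: "('i::finite \<Rightarrow> 'a::real_vector) \<Rightarrow> bool" where
  "dependent_family f \<longleftrightarrow> (\<exists>c. (\<exists>i. c i \<noteq> 0) \<and> (\<Sum>i\<in>UNIV. c i *\<^sub>R f i) = 0)"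

end

theory Submission
  imports Defs
begin

text \<open>
  Let \<open>J (Z, V, X\<^sub>0, X\<^sub>1) = (V\<^sup>T, Z\<^sup>T, X\<^sub>0\<^sup>T, -X\<^sub>1\<^sup>T)\<close>. Then \<open>J H = - H J\<close>, hence \<open>J e\<^sup>H\<close> is conjugate
  to \<open>J\<close>: with \<open>G = H / 2\<close> we have \<open>w - J e\<^sup>H w = e\<^sup>-\<^sup>G (u - J u)\<close> for \<open>u = e\<^sup>G w\<close>. The trace of the
  first boundary condition, together with all entries of the second and third ones, are
  \<open>2 n\<^sup>2 + 1\<close> functionals of \<open>w - J e\<^sup>H w\<close>. This vector ranges over the image of the
  \<open>(-1)\<close>-eigenspace of \<open>J\<close> under \<open>e\<^sup>-\<^sup>G\<close>, which has dimension \<open>2 n\<^sup>2\<close>; so these functionals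
  are linearly dependent. The bound on the null space is rank-nullity.
\<close>

subsection \<open>The matrix exponential\<close>

lemma has_vector_derivative_vecI:
  fixes f :: "real \<Rightarrow> ('a::real_normed_vector)^'n"
  assumes "\<And>i. ((\<lambda>t. f t $ i) has_vector_derivative D $ i) (at t within S)"
  shows "(f has_vector_derivative D) (at t within S)"
  using assms unfolding has_vector_derivative_def has_derivative_within
  by (auto intro!: vec_tendstoI bounded_linear_intros)

text \<open>Bilinear maps between finite-dimensional spaces are bounded. Registering both products
  in this form provides the product rule for derivatives and moves infinite sums through
  products.\<close>

lemma bounded_bilinear_matrix_vector_mult: "bounded_bilinear ((*v) :: real^'n^'m \<Rightarrow> _)"
  by (simp add: bilinear_conv_bounded_bilinear[symmetric] bilinear_def linear_iff algebra_simps
      scaleR_matrix_vector_assoc matrix_vector_mult_scaleR)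

lemma bounded_bilinear_matrix_matrix_mult:
  "bounded_bilinear ((**) :: real^'n^'m \<Rightarrow> real^'k^'n \<Rightarrow> real^'k^'m)"
  by (simp add: bilinear_conv_bounded_bilinear[symmetric] bilinear_def linear_iff
      matrix_add_ldistrib matrix_scalar_ac scalar_matrix_assoc)
    (simp add: vec_eq_iff matrix_matrix_mult_def algebra_simps sum.distrib)

interpretation mv: bounded_bilinear "(*v) :: real^'n^'m \<Rightarrow> _"
  by (rule bounded_bilinear_matrix_vector_mult)

interpretation mm: bounded_bilinear "(**) :: real^'n^'m \<Rightarrow> real^'k^'n \<Rightarrow> real^'k^'m"
  by (rule bounded_bilinear_matrix_matrix_mult)

lemma matrix_power_0 [simp]: "matrix_power A 0 = mat 1"
  and matrix_power_Suc [simp]: "matrix_power A (Suc k) = A ** matrix_power A k"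
  by (simp_all add: matrix_power_def)

lemma matrix_power_scaleR: "matrix_power (t *\<^sub>R A) k = t ^ k *\<^sub>R matrix_power A k"
  by (induction k) (simp_all add: mm.scaleR_left mm.scaleR_right)

text \<open>The sum of the absolute values of all entries dominates every row sum, so each further
  factor \<open>A\<close> costs at most one factor of this constant.\<close>

lemma matrix_power_bound:
  fixes A :: "real^'n^'n"
  shows "\<bar>matrix_power A k $ i $ j\<bar> \<le> (\<Sum>i\<in>UNIV. \<Sum>j\<in>UNIV. \<bar>A $ i $ j\<bar>) ^ k" (is "_ \<le> ?C ^ k")
proof (induction k arbitrary: i j)
  case 0
  then show ?case by (simp add: mat_def)
next
  case (Suc k)
  have "\<bar>matrix_power A (Suc k) $ i $ j\<bar> \<le> (\<Sum>l\<in>UNIV. \<bar>A $ i $ l\<bar> * ?C ^ k)"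
    unfolding matrix_power_Suc matrix_matrix_mult_def
    by (auto intro!: order_trans[OF sum_abs] sum_mono mult_left_mono Suc simp: abs_mult)
  also have "\<dots> = (\<Sum>l\<in>UNIV. \<bar>A $ i $ l\<bar>) * ?C ^ k"
    by (simp add: sum_distrib_right)
  also have "\<dots> \<le> ?C * ?C ^ k"
    by (intro mult_right_mono member_le_sum[of i UNIV "\<lambda>i. \<Sum>l\<in>UNIV. \<bar>A $ i $ l\<bar>"])
      (auto intro!: sum_nonneg zero_le_power)
  finally show ?case by simp
qed

text \<open>Comparison with the scalar exponential series. The factor \<open>t ^ k\<close> makes
  each entry a power series in \<open>t\<close>, ready for termwise differentiation.\<close>

lemma summable_matrix_exp_nth:
  fixes A :: "real^'n^'n"
  shows "summable (\<lambda>k. matrix_power A k $ i $ j / fact k * t ^ k)"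
proof (rule summable_comparison_test')
  let ?C = "\<Sum>i\<in>UNIV. \<Sum>j\<in>UNIV. \<bar>A $ i $ j\<bar>"
  show "summable (\<lambda>k. (?C * \<bar>t\<bar>) ^ k /\<^sub>R fact k)"
    by (rule summable_exp_generic)
  show "norm (matrix_power A k $ i $ j / fact k * t ^ k) \<le> (?C * \<bar>t\<bar>) ^ k /\<^sub>R fact k" for k
    using mult_right_mono[OF matrix_power_bound[of A k i j], of "\<bar>t\<bar> ^ k"]
    by (simp add: abs_mult power_abs power_mult_distrib field_simps)
qed

text \<open>Convergence of every entry gives convergence of the matrices, so the infinite sum that
  defines \<open>matrix_exp\<close> is a genuine limit.\<close>

lemma matrix_exp_sums:
  fixes A :: "real^'n^'n"
  shows "(\<lambda>k. (1 / fact k) *\<^sub>R matrix_power A k) sums matrix_exp A"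
proof -
  have "(\<lambda>k. (1 / fact k) *\<^sub>R matrix_power A k)
      sums (\<chi> i j. \<Sum>k. matrix_power A k $ i $ j / fact k)"
    using summable_sums[OF summable_matrix_exp_nth[of A _ _ 1]]
    by (auto simp: sums_def intro!: vec_tendstoI)
  then show ?thesis
    unfolding matrix_exp_def by (rule summable_sums[OF sums_summable])
qed

lemma matrix_exp_scaleR_nth_sums:
  "(\<lambda>k. matrix_power A k $ i $ j / fact k * t ^ k) sums (matrix_exp (t *\<^sub>R A) $ i $ j)"
  using sums_vec_nth[OF sums_vec_nth[OF matrix_exp_sums[of "t *\<^sub>R A"]]]
  by (simp add: matrix_power_scaleR mult_ac)

lemma matrix_exp_0 [simp]: "matrix_exp (0 :: real^'n^'n) = mat 1"
proof (rule sums_unique2[OF matrix_exp_sums])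
  have "(1 / fact k) *\<^sub>R matrix_power (0 :: real^'n^'n) k = (if k = 0 then mat 1 else 0)" for k
    by (cases k) (simp_all add: mm.zero_left)
  then show "(\<lambda>k. (1 / fact k) *\<^sub>R matrix_power (0 :: real^'n^'n) k) sums mat 1"
    using sums_single[of 0 "\<lambda>_. mat 1 :: real^'n^'n"] by simp
qed

text \<open>The relation passes to all powers by induction, then to the series because
  multiplication by \<open>X\<close> is continuous. With \<open>X = A\<close> it yields that
  \<open>A\<close> commutes with its exponentials; with \<open>X = reflection\<close> it turns
  \<open>matrix_exp G\<close> into \<open>matrix_exp (- G)\<close>.\<close>

lemma matrix_exp_intertwine:
  fixes X :: "real^'n^'m"
  assumes "X ** A = B ** X"
  shows "X ** matrix_exp A = matrix_exp B ** X"
proof (rule sums_unique2)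
  have "X ** matrix_power A k = matrix_power B k ** X" for k
  proof (induction k)
    case (Suc k)
    then show ?case using assms by (metis matrix_mul_assoc matrix_power_Suc)
  qed simp
  then show "(\<lambda>k. (1 / fact k) *\<^sub>R (X ** matrix_power A k)) sums (matrix_exp B ** X)"
    using bounded_linear.sums[OF mm.bounded_linear_left matrix_exp_sums]
    by (simp add: mm.scaleR_left)
  show "(\<lambda>k. (1 / fact k) *\<^sub>R (X ** matrix_power A k)) sums (X ** matrix_exp A)"
    using bounded_linear.sums[OF mm.bounded_linear_right matrix_exp_sums]
    by (simp add: mm.scaleR_right)
qed

section \<open>Linear differential equations with constant coefficients\<close>

lemma matrix_exp_has_vector_derivative:
  fixes A :: "real^'n^'n"
  shows "((\<lambda>t. matrix_exp (t *\<^sub>R A)) has_vector_derivative A ** matrix_exp (t *\<^sub>R A)) (at t within S)"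
proof (intro has_vector_derivative_vecI)
  fix i j
  let ?c = "\<lambda>k. matrix_power A k $ i $ j / fact k"
  \<comment> \<open>Differentiation shifts the series by one: the factor \<open>k + 1\<close>
    cancels against \<open>fact (k + 1)\<close> and leaves one extra factor \<open>A\<close> in
    front of the \<open>k\<close>-th term.\<close>
  have "diffs ?c k * t ^ k = (A ** ((1 / fact k) *\<^sub>R matrix_power (t *\<^sub>R A) k)) $ i $ j" for k
    by (simp add: diffs_def matrix_power_scaleR mm.scaleR_right field_simps del: of_nat_Suc)
  moreover have "(\<lambda>k. (A ** ((1 / fact k) *\<^sub>R matrix_power (t *\<^sub>R A) k)) $ i $ j)
      sums ((A ** matrix_exp (t *\<^sub>R A)) $ i $ j)"
    by (intro sums_vec_nth bounded_linear.sums[OF mm.bounded_linear_right] matrix_exp_sums)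
  ultimately have "(\<Sum>k. diffs ?c k * t ^ k) = (A ** matrix_exp (t *\<^sub>R A)) $ i $ j"
    by (simp add: sums_iff)
  moreover have "(\<lambda>t. matrix_exp (t *\<^sub>R A) $ i $ j) = (\<lambda>t. \<Sum>k. ?c k * t ^ k)"
    by (simp add: sums_unique[OF matrix_exp_scaleR_nth_sums])
  ultimately have "((\<lambda>t. matrix_exp (t *\<^sub>R A) $ i $ j) has_field_derivative
      (A ** matrix_exp (t *\<^sub>R A)) $ i $ j) (at t)"
    using termdiffs_strong_converges_everywhere[OF summable_matrix_exp_nth, of A i j t] by simp
  then show "((\<lambda>t. matrix_exp (t *\<^sub>R A) $ i $ j) has_vector_derivative
      (A ** matrix_exp (t *\<^sub>R A)) $ i $ j) (at t within S)"
    by (simp add: has_real_derivative_iff_has_vector_derivative has_vector_derivative_at_within)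
qed

lemma matrix_exp_neg_has_vector_derivative:
  fixes A :: "real^'n^'n"
  shows "((\<lambda>t. matrix_exp (- t *\<^sub>R A)) has_vector_derivative - (matrix_exp (- t *\<^sub>R A) ** A))
    (at t within S)"
proof -
  have "A ** matrix_exp (t *\<^sub>R - A) = matrix_exp (t *\<^sub>R - A) ** A"
    by (rule matrix_exp_intertwine) (simp add: mm.minus_left mm.minus_right mm.scaleR_left mm.scaleR_right)
  then show ?thesis
    using matrix_exp_has_vector_derivative[of "- A" t S] by (simp add: mm.minus_left)
qed

text \<open>By the product rule the derivative is \<open>- e^(-tA) A w + e^(-tA) A w = 0\<close>,
  and a function with zero derivative on a convex set is constant. A general \<open>S\<close> covers
  both the whole line and the interval from 0 to 1.\<close>

lemma matrix_exp_neg_mult_const: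
  fixes A :: "real^'n^'n"
  assumes "convex S" "0 \<in> S" "t \<in> S"
    and "\<And>t. t \<in> S \<Longrightarrow> (w has_vector_derivative A *v w t) (at t within S)"
  shows "matrix_exp (- t *\<^sub>R A) *v w t = w 0"
proof -
  have "((\<lambda>t. matrix_exp (- t *\<^sub>R A) *v w t) has_vector_derivative 0) (at t within S)" if "t \<in> S" for t
    using mv.has_vector_derivative[OF matrix_exp_neg_has_vector_derivative[of A] assms(4)[OF that]]
    by (simp add: mv.minus_left matrix_vector_mul_assoc)
  from has_vector_derivative_zero_constant[OF assms(1) this] obtain c where
    "\<And>t. t \<in> S \<Longrightarrow> matrix_exp (- t *\<^sub>R A) *v w t = c" by blast
  then show ?thesis using assms(2,3) by (metis matrix_exp_0 matrix_vector_mul_lid minus_zero scaleR_zero_left)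
qed

lemma matrix_exp_mult_vec_has_vector_derivative:
  fixes A :: "real^'n^'n"
  shows "((\<lambda>t. matrix_exp (t *\<^sub>R A) *v x) has_vector_derivative A *v (matrix_exp (t *\<^sub>R A) *v x))
    (at t within S)"
  using bounded_linear.has_vector_derivative[OF mv.bounded_linear_left matrix_exp_has_vector_derivative]
  by (simp add: matrix_vector_mul_assoc)

text \<open>The curve \<open>e^(tA) x\<close> solves the equation and starts at \<open>x\<close>;
  the constancy above is evaluated at \<open>t = 1\<close>.\<close>

lemma matrix_exp_neg_left: "matrix_exp (- A) ** matrix_exp A = mat 1" for A :: "real^'n^'n"
proof -
  have "matrix_exp (- A) *v (matrix_exp A *v x) = x" for x
    using matrix_exp_neg_mult_const[OF convex_UNIV UNIV_I UNIV_I
        matrix_exp_mult_vec_has_vector_derivative, of 1 A x] by simp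
  then show ?thesis by (simp add: matrix_eq matrix_vector_mul_assoc[symmetric])
qed

lemma matrix_exp_neg_right: "matrix_exp A ** matrix_exp (- A) = mat 1" for A :: "real^'n^'n"
  using matrix_exp_neg_left[of "- A"] by simp

lemma linear_ode_unique:
  fixes A :: "real^'n^'n"
  assumes "convex S" "0 \<in> S" "t \<in> S"
    and "\<And>t. t \<in> S \<Longrightarrow> (w has_vector_derivative A *v w t) (at t within S)"
  shows "w t = matrix_exp (t *\<^sub>R A) *v w 0"
  using matrix_exp_neg_mult_const[OF assms] matrix_exp_neg_right[of "t *\<^sub>R A"]
  by (metis matrix_vector_mul_assoc matrix_vector_mul_lid scaleR_minus_left)

text \<open>The shifted curve \<open>e^((t+1)A) x\<close> solves the same equation with initial
  value \<open>e^A x\<close>, so uniqueness at \<open>t = 1\<close> applies. This lets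
  \<open>e^H\<close> be split into two equal halves.\<close>

lemma matrix_exp_double: "matrix_exp (2 *\<^sub>R A) = matrix_exp A ** matrix_exp A" for A :: "real^'n^'n"
proof -
  have "matrix_exp (2 *\<^sub>R A) *v x = matrix_exp A *v (matrix_exp A *v x)" for x
  proof -
    have "((\<lambda>t. matrix_exp ((t + 1) *\<^sub>R A) *v x) has_vector_derivative
        A *v (matrix_exp ((t + 1) *\<^sub>R A) *v x)) (at t)" for t
      using vector_diff_chain_at[of "\<lambda>t. t + 1" 1 t, OF _ matrix_exp_mult_vec_has_vector_derivative[of A x "t + 1"]]
      by (simp add: o_def has_vector_derivative_add_const has_vector_derivative_id)
    from linear_ode_unique[OF convex_UNIV UNIV_I UNIV_I this, of 1]
    show ?thesis by simp
  qed
  then show ?thesis by (simp add: matrix_eq matrix_vector_mul_assoc[symmetric])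
qed

subsection \<open>Vectorized states and the reflection\<close>

lemma vectorize_linear: "linear (vectorize :: real^'n^'m \<Rightarrow> _)"
  by (simp add: linear_iff vectorize_def vec_eq_iff)

lemmas vectorize_simps = linear_add[OF vectorize_linear] linear_diff[OF vectorize_linear]
  linear_neg[OF vectorize_linear] linear_scale[OF vectorize_linear]

text \<open>Stacking columns only reorders the entries. Functionals on vectorized blocks can
  therefore be computed as Frobenius inner products of matrices, where traces and transposes are
  easy to handle.\<close>

lemma inner_vectorize: "vectorize A \<bullet> vectorize B = A \<bullet> (B :: real^'n^'m)"
  by (simp add: inner_vec_def vectorize_def UNIV_Times_UNIV[symmetric] sum.cartesian_product'
      sum.swap[of "\<lambda>i j. A $ i $ j * B $ i $ j"] del: UNIV_Times_UNIV)

lemma inner_transpose: "transpose A \<bullet> transpose B = A \<bullet> (B :: real^'n^'m)"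
  unfolding inner_vec_def transpose_def by simp (rule sum.swap)

definition unvectorize :: "real^('n \<times> 'm) \<Rightarrow> real^'n^'m" where
  "unvectorize x = (\<chi> i j. x $ (j, i))"

lemma vectorize_unvectorize [simp]: "vectorize (unvectorize x) = x"
  by (simp add: vectorize_def unvectorize_def vec_eq_iff)

lemma kronecker_transpose_mat_mult_vectorize:
  "(transpose A \<otimes>\<^sub>K mat 1) *v vectorize X = vectorize (X ** A)"
  using vectorize_matrix_mult[of "mat 1" X A] by simp

lemma kronecker_mat_mult_vectorize: "(mat 1 \<otimes>\<^sub>K A) *v vectorize X = vectorize (A ** X)"
  using vectorize_matrix_mult[of A X "mat 1"] by (simp add: transpose_mat)

lemma kronecker_mat_mat_mult [simp]: "(mat 1 \<otimes>\<^sub>K mat 1) *v x = x" for x :: "real^('n::finite \<times> 'm::finite)"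
  using kronecker_mat_mult_vectorize[of "mat 1" "unvectorize x"] by simp

definition stack :: "(real^'d)^'b \<Rightarrow> real^('b \<times> 'd)" where
  "stack x = (\<chi> p. x $ fst p $ snd p)"

lemma stack_nth [simp]: "stack x $ (i, p) = x $ i $ p"
  by (simp add: stack_def)

lemma block_matrix_mult_stack:
  "block_matrix B *v stack x = stack (\<chi> a. \<Sum>b\<in>UNIV. B $ a $ b *v x $ b)"
  by (simp add: vec_eq_iff stack_def block_matrix_def matrix_vector_mult_def sum_component
      UNIV_Times_UNIV[symmetric] sum.cartesian_product' del: UNIV_Times_UNIV)

lemma inner_stack: "stack x \<bullet> stack y = x \<bullet> y"
  by (simp add: inner_vec_def UNIV_Times_UNIV[symmetric] sum.cartesian_product' del: UNIV_Times_UNIV)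

lemma stack_linear: "linear (stack :: (real^'d)^'b \<Rightarrow> _)"
  by (simp add: linear_iff stack_def vec_eq_iff)

definition state :: "real^'n^'n \<Rightarrow> real^'n^'n \<Rightarrow> real^'n^'n \<Rightarrow> real^'n^'n \<Rightarrow> real^(4 \<times> 'n \<times> 'n)" where
  "state Z V X0 X1 = stack (vector [vectorize Z, vectorize V, vectorize X0, vectorize X1])"

lemma state_nth [simp]:
  "state Z V X0 X1 $ (1, i, j) = Z $ j $ i" "state Z V X0 X1 $ (2, i, j) = V $ j $ i"
  "state Z V X0 X1 $ (3, i, j) = X0 $ j $ i" "state Z V X0 X1 $ (4, i, j) = X1 $ j $ i"
  by (simp_all add: state_def vectorize_def)

lemma vec4_eq_iff:
  "x = y \<longleftrightarrow> (\<forall>i j. x $ (1, i, j) = y $ (1, i, j) \<and> x $ (2, i, j) = y $ (2, i, j)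
    \<and> x $ (3, i, j) = y $ (3, i, j) \<and> x $ (4, i, j) = y $ (4, i, j))"
  for x y :: "real^(4 \<times> 'n::finite \<times> 'n)"
  by (auto simp: vec_eq_iff forall_4)

lemma state_exhaust:
  obtains Z V X0 X1 where "w = state Z V X0 X1"
proof
  show "w = state (\<chi> i j. w $ (1, j, i)) (\<chi> i j. w $ (2, j, i)) (\<chi> i j. w $ (3, j, i))
      (\<chi> i j. w $ (4, j, i))"
    by (simp add: vec4_eq_iff)
qed

lemma state_eq_iff:
  "state Z V X0 X1 = state Z' V' X0' X1' \<longleftrightarrow> Z = Z' \<and> V = V' \<and> X0 = X0' \<and> X1 = X1'"
  by (auto simp: vec4_eq_iff vec_eq_iff)

lemma state_diff: "state Z V X0 X1 - state Z' V' X0' X1' = state (Z - Z') (V - V') (X0 - X0') (X1 - X1')"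
  and state_minus: "- state Z V X0 X1 = state (- Z) (- V) (- X0) (- X1)"
  and state_add: "state Z V X0 X1 + state Z' V' X0' X1' = state (Z + Z') (V + V') (X0 + X0') (X1 + X1')"
  and state_scaleR: "c *\<^sub>R state Z V X0 X1 = state (c *\<^sub>R Z) (c *\<^sub>R V) (c *\<^sub>R X0) (c *\<^sub>R X1)"
  by (simp_all add: vec4_eq_iff)

lemma inner_state:
  "state Z V X0 X1 \<bullet> state Z' V' X0' X1' = Z \<bullet> Z' + V \<bullet> V' + X0 \<bullet> X0' + X1 \<bullet> X1'"
  unfolding state_def inner_stack inner_vec_def[of "_ :: _^4"]
  by (simp add: sum_4 inner_vectorize)

text \<open>Each Kronecker block with an identity factor is a one-sided multiplication, which
  identifies \<open>H_matrix\<close> with the right-hand side of the matrix system.\<close>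

lemma H_mult_state:
  "H_matrix A0 A1 B0 B1 *v state Z V X0 X1 = state
     (Z ** A0 + V ** A1 + X0 ** B0 + X1 ** B1)
     (- (transpose A1 ** Z) - transpose A0 ** V - transpose B0 ** X0 + transpose B1 ** X1)
     (- (pi *\<^sub>R X1)) (Z + V + pi *\<^sub>R X0)"
  unfolding H_matrix_def Let_def state_def block_matrix_mult_stack
  by (rule arg_cong[of _ _ stack])
    (simp add: vec_eq_iff[of _ "vector _"] forall_4 sum_4 vectorize_simps mv.minus_left mv.scaleR_left
      kronecker_transpose_mat_mult_vectorize kronecker_mat_mult_vectorize)

text \<open>
  On initial data, \<open>reflection\<close> acts as
  \<open>(Z, V, X\<^sub>0, X\<^sub>1) \<mapsto> (V\<^sup>T, Z\<^sup>T, X\<^sub>0\<^sup>T, -X\<^sub>1\<^sup>T)\<close>; combined with \<open>\<tau> \<mapsto> 1 - \<tau>\<close> it maps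
  solutions of the system to solutions.
\<close>

definition reflection :: "real^(4 \<times> 'n::finite \<times> 'n)^(4 \<times> 'n \<times> 'n)" where
  "reflection =
     (let T = commutation_matrix in block_matrix (vector [
       vector [0, T, 0, 0],
       vector [T, 0, 0, 0],
       vector [0, 0, T, 0],
       vector [0, 0, 0, - T]]))"

lemma reflection_mult_state:
  "reflection *v state Z V X0 X1 = state (transpose V) (transpose Z) (transpose X0) (- transpose X1)"
  unfolding reflection_def Let_def state_def block_matrix_mult_stack
  by (rule arg_cong[of _ _ stack])
    (simp add: vec_eq_iff[of _ "vector _"] forall_4 sum_4 vectorize_simps mv.minus_left
      vectorize_transpose)

text \<open>Transposition reverses products, so the right multiplications in the equation for
  \<open>Z\<close> and the left multiplications in the one for \<open>V\<close> are exchanged up to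
  sign. The sign change of \<open>X1\<close> accounts for the terms with \<open>B1\<close> and
  \<open>pi\<close>.\<close>

lemma reflection_H: "reflection ** H_matrix A0 A1 B0 B1 = - H_matrix A0 A1 B0 B1 ** reflection"
proof -
  have "reflection *v (H_matrix A0 A1 B0 B1 *v w) = - (H_matrix A0 A1 B0 B1 *v (reflection *v w))" for w
  proof (cases w rule: state_exhaust)
    case (1 Z V X0 X1)
    have [simp]: "transpose (X + Y) = transpose X + transpose Y"
      "transpose (X - Y) = transpose X - transpose Y" "transpose (- X) = - transpose X"
      for X Y :: "real^'n^'n"
      by (simp_all add: transpose_def vec_eq_iff)
    show ?thesis
      by (simp add: 1 reflection_mult_state H_mult_state state_minus state_eq_iff
          matrix_transpose_mul transpose_scalar mm.minus_left mm.minus_right)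
  qed
  then show ?thesis
    by (simp add: matrix_eq matrix_vector_mul_assoc[symmetric] mv.minus_left)
qed

text \<open>Self-adjointness: a functional fixed by \<open>reflection\<close> vanishes on every
  difference \<open>u - reflection *v u\<close>.\<close>

lemma inner_reflection:
  fixes x y :: "real^(4 \<times> 'n::finite \<times> 'n)"
  shows "x \<bullet> (reflection *v y) = (reflection *v x) \<bullet> y"
proof (cases x rule: state_exhaust; cases y rule: state_exhaust)
  fix Z V X0 X1 Z' V' X0' X1' :: "real^'n^'n"
  assume "x = state Z V X0 X1" "y = state Z' V' X0' X1'"
  moreover have "A \<bullet> transpose B = transpose A \<bullet> B" for A B :: "real^'n^'n"
    using inner_transpose[of "transpose A" B] by simp
  ultimately show ?thesis by (simp add: reflection_mult_state inner_state)
qed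

text \<open>The primed matrices play the role of the values at time 1; the three blocks are then the
  vectorized boundary residuals.\<close>

lemma M_mult_state:
  assumes "matrix_exp (H_matrix A0 A1 B0 B1) *v state Z V X0 X1 = state Z' V' X0' X1'"
  shows "M_matrix A0 A1 B0 B1 *v state Z V X0 X1 = stack (vector [vectorize (Z - V'),
     vectorize (X0 - transpose X0'), vectorize (X1 + transpose X1')])"
  unfolding M_matrix_def Let_def mv.add_left matrix_vector_mul_assoc[symmetric] assms
  unfolding state_def block_matrix_mult_stack linear_add[OF stack_linear, symmetric]
  by (rule arg_cong[of _ _ stack])
    (simp add: vec_eq_iff[of _ "vector _"] forall_3 sum_4 vectorize_simps mv.minus_left
      vectorize_transpose)

subsection \<open>Linear dependence of the boundary conditions\<close>

lemma linear_not_injective: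
  fixes f :: "'a::euclidean_space \<Rightarrow> 'b::euclidean_space"
  assumes "linear f" "DIM('b) < DIM('a)"
  obtains x where "x \<noteq> 0" "f x = 0"
proof -
  have "\<not> inj f"
  proof
    assume "inj f"
    then have "dim (f ` UNIV) = DIM('a)"
      using dim_image_eq[OF \<open>linear f\<close>, of UNIV] by simp
    with assms(2) show False
      using dim_subset_UNIV[of "f ` UNIV"] by simp
  qed
  with that show thesis
    using linear_injective_0[OF \<open>linear f\<close>] by blast
qed

text \<open>
  The invariance of \<open>P *v state \<dots>\<close> amounts to \<open>2 n\<^sup>2\<close> linear equations: the first
  two blocks have to be transposes of each other; the third and fourth ones have to be symmetric and antisymmetric, respectively, and the two conditions add up
  to a single matrix equation. There are \<open>2 n\<^sup>2 + 1\<close> unknowns.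
\<close>

lemma reflection_invariant_functional:
  fixes P :: "real^(4 \<times> 'n::finite \<times> 'n)^(4 \<times> 'n \<times> 'n)"
  obtains t C2 C3 where "(t, C2, C3) \<noteq> 0"
    "reflection *v (P *v state (t *\<^sub>R mat 1) 0 C2 C3) = P *v state (t *\<^sub>R mat 1) 0 C2 C3"
proof -
  define g :: "real \<times> (real^'n^'n) \<times> (real^'n^'n) \<Rightarrow> _"
    where "g x = P *v state (fst x *\<^sub>R mat 1) 0 (fst (snd x)) (snd (snd x))" for x
  define h :: "real^(4 \<times> 'n \<times> 'n) \<Rightarrow> (real^'n^'n) \<times> (real^'n^'n)" where
    "h f = (\<chi> i j. f $ (1, j, i) - f $ (2, i, j),
      \<chi> i j. f $ (3, j, i) - f $ (3, i, j) + f $ (4, j, i) + f $ (4, i, j))" for f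
  have "linear g"
    unfolding g_def
    by (simp add: linear_iff mv.add_right[symmetric] mv.scaleR_right[symmetric] state_add state_scaleR
        scaleR_left_distrib)
  moreover have "linear h"
    by (simp add: linear_iff h_def vec_eq_iff algebra_simps)
  ultimately have "linear (h \<circ> g)"
    by (rule linear_compose)
  then obtain x where x: "x \<noteq> 0" "h (g x) = 0"
    by (rule linear_not_injective) (simp add: o_def)+
  have "reflection *v f = f" if "h f = 0" for f
  proof (cases f rule: state_exhaust)
    case (1 F1 F2 F3 F4)
    have 2: "F1 $ i $ j = F2 $ j $ i" and 3: "F3 $ i $ j - F3 $ j $ i + F4 $ i $ j + F4 $ j $ i = 0" for i j
      using that by (simp_all add: 1 h_def vec_eq_iff zero_prod_def)
    \<comment> \<open>The \<open>F3\<close> part of the equation is antisymmetric and the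
      \<open>F4\<close> part symmetric, so subtracting and adding the equations at
      \<open>(i, j)\<close> and \<open>(j, i)\<close> separates them.\<close>
    have 4: "F3 $ j $ i = F3 $ i $ j" "- F4 $ j $ i = F4 $ i $ j" for i j
      using 3[of i j] 3[of j i] by linarith+
    have "transpose F1 = F2" "transpose F2 = F1"
      by (simp_all add: vec_eq_iff transpose_def 2)
    moreover have "transpose F3 = F3" "- transpose F4 = F4"
      unfolding vec_eq_iff transpose_def by (auto simp: 4)
    ultimately show ?thesis
      by (simp add: 1 reflection_mult_state)
  qed
  with x that[of "fst x" "fst (snd x)" "snd (snd x)"] show thesis
    by (simp add: g_def)
qed

lemma M_left_null_vector:
  fixes A0 A1 B0 B1 :: "real^'n^'n"
  obtains c where "c \<noteq> 0" "\<And>w. c \<bullet> (M_matrix A0 A1 B0 B1 *v w) = 0"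
proof -
  define H where "H = H_matrix A0 A1 B0 B1"
  define G where "G = (1/2) *\<^sub>R H"
  \<comment> \<open>The transpose appears because \<open>matrix_exp (- G)\<close> is going to be
    moved to the other side of an inner product.\<close>
  obtain t C2 C3 where nz: "(t, C2, C3) \<noteq> 0" and
    inv: "reflection *v (transpose (matrix_exp (- G)) *v state (t *\<^sub>R mat 1) 0 C2 C3)
      = transpose (matrix_exp (- G)) *v state (t *\<^sub>R mat 1) 0 C2 C3"
    by (rule reflection_invariant_functional)
  define s where "s = state (t *\<^sub>R mat 1) 0 C2 C3"
  define c :: "real^(3 \<times> 'n \<times> 'n)"
    where "c = stack (vector [vectorize (t *\<^sub>R mat 1), vectorize C2, vectorize C3])"
  have "c \<noteq> 0"
  proof
    assume "c = 0"
    then have "c $ (k, j, i) = 0" for k i j by simp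
    \<comment> \<open>Any diagonal entry of the first block equals \<open>t\<close>;
      \<open>undefined\<close> picks an arbitrary one.\<close>
    from this[of 1 undefined undefined] this[of 2] this[of 3] have "t = 0" "C2 = 0" "C3 = 0"
      by (simp_all add: c_def vectorize_def vec_eq_iff mat_def)
    with nz show False by (simp add: zero_prod_def)
  qed
  moreover have "c \<bullet> (M_matrix A0 A1 B0 B1 *v w) = 0" for w
  proof (cases w rule: state_exhaust)
    case (1 Z V X0 X1)
    obtain Z' V' X0' X1' where w': "matrix_exp H *v w = state Z' V' X0' X1'"
      by (rule state_exhaust)
    \<comment> \<open>The first residual contains \<open>V'\<close>, but the first block of
      \<open>w - reflection *v (matrix_exp H *v w)\<close> contains its transpose. The trace does
      not distinguish them, which is why the first block of \<open>c\<close> is a multiple of the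
      identity. The zero block of \<open>s\<close> discards the second component.\<close>
    have tr: "mat 1 \<bullet> transpose A = mat 1 \<bullet> A" for A :: "real^'n^'n"
      using inner_transpose[of "mat 1" A] by (simp add: transpose_mat)
    have "c \<bullet> (M_matrix A0 A1 B0 B1 *v w) = s \<bullet> (w - reflection *v (matrix_exp H *v w))"
      using w' unfolding 1
      by (simp add: H_def M_mult_state c_def s_def inner_stack inner_vec_def[of "_ :: _^3"] sum_3
          inner_vectorize reflection_mult_state state_diff inner_state tr inner_diff_right)
    also have "w - reflection *v (matrix_exp H *v w)
        = matrix_exp (- G) *v (matrix_exp G *v w - reflection *v (matrix_exp G *v w))"
    proof -
      have "reflection ** G = - G ** reflection"
        using reflection_H[of A0 A1 B0 B1]
        by (simp add: G_def H_def mm.scaleR_left mm.scaleR_right mm.minus_left)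
      then have "reflection ** matrix_exp G = matrix_exp (- G) ** reflection"
        by (rule matrix_exp_intertwine)
      then have "reflection *v (matrix_exp G *v x) = matrix_exp (- G) *v (reflection *v x)" for x
        by (simp add: matrix_vector_mul_assoc)
      moreover have "matrix_exp H = matrix_exp G ** matrix_exp G"
        using matrix_exp_double[of G] by (simp add: G_def)
      ultimately have "reflection *v (matrix_exp H *v w)
          = matrix_exp (- G) *v (reflection *v (matrix_exp G *v w))"
        by (simp add: matrix_vector_mul_assoc[symmetric])
      moreover have "w = matrix_exp (- G) *v (matrix_exp G *v w)"
        by (simp add: matrix_vector_mul_assoc matrix_exp_neg_left)
      ultimately show ?thesis by (simp add: mv.diff_right)
    qed
    also have "s \<bullet> \<dots> = (transpose (matrix_exp (- G)) *v s)
        \<bullet> (matrix_exp G *v w - reflection *v (matrix_exp G *v w))"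
      by (simp add: dot_lmul_matrix)
    also have "\<dots> = 0"
      using inv by (simp add: s_def[symmetric] inner_diff_right inner_reflection)
    finally show ?thesis .
  qed
  ultimately show thesis by (rule that)
qed

section \<open>Dependence of rows and dimension of the null space\<close>

lemma dependent_rows_iff:
  fixes A :: "real^'n^'m"
  shows "dependent_family (\<lambda>i. row i A) \<longleftrightarrow> (\<exists>c. c \<noteq> 0 \<and> (\<forall>w. c \<bullet> (A *v w) = 0))"
proof -
  have "(\<Sum>i\<in>UNIV. c $ i *\<^sub>R row i A) = 0 \<longleftrightarrow> (\<forall>w. c \<bullet> (A *v w) = 0)" for c
  proof -
    have "(\<Sum>i\<in>UNIV. c $ i *\<^sub>R row i A) = c v* A"
      by (simp add: vec_eq_iff row_def vector_matrix_mult_def sum_component mult.commute)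
    then show ?thesis
      using all_zero_iff[of "c v* A"] by (metis dot_lmul_matrix inner_commute)
  qed
  moreover have "dependent_family f \<longleftrightarrow> (\<exists>c. c \<noteq> 0 \<and> (\<Sum>i\<in>UNIV. c $ i *\<^sub>R f i) = 0)"
    for f :: "'m \<Rightarrow> real^'n"
  proof
    assume "dependent_family f"
    then obtain c i where "c i \<noteq> 0" "(\<Sum>i\<in>UNIV. c i *\<^sub>R f i) = 0"
      by (auto simp: dependent_family_def)
    then have "(\<chi> i. c i) \<noteq> 0" "(\<Sum>i\<in>UNIV. (\<chi> i. c i) $ i *\<^sub>R f i) = 0"
      by (auto simp: vec_eq_iff)
    then show "\<exists>c. c \<noteq> 0 \<and> (\<Sum>i\<in>UNIV. c $ i *\<^sub>R f i) = 0" by blast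
  qed (auto simp: dependent_family_def vec_eq_iff)
  ultimately show ?thesis by simp
qed

text \<open>The null space is the orthogonal complement of the row space, whose dimension is the
  rank.\<close>

lemma dim_null_space:
  fixes A :: "real^'n^'m"
  shows "dim {x. A *v x = 0} + rank A = CARD('n)"
proof -
  have row: "row i A = A $ i" for i
    by (simp add: row_def)
  have "{x. A *v x = 0} = {y. \<forall>x\<in>span (rows A). orthogonal x y}"
  proof (intro Collect_cong iffI ballI)
    fix y x
    assume "A *v y = 0" "x \<in> span (rows A)"
    then have "\<forall>z\<in>rows A. orthogonal y z"
      by (auto simp: rows_def row orthogonal_def vec_eq_iff[of "A *v y"] matrix_vector_mul_component
          inner_commute)
    then show "orthogonal x y"
      using orthogonal_to_span[OF \<open>x \<in> span (rows A)\<close>] by (metis orthogonal_commute)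
  next
    fix y
    assume "\<forall>x\<in>span (rows A). orthogonal x y"
    then have "orthogonal (row i A) y" for i
      by (auto simp: rows_def intro: span_base)
    then show "A *v y = 0"
      by (simp add: vec_eq_iff matrix_vector_mul_component orthogonal_def row[symmetric])
  qed
  then show ?thesis
    using dim_subspace_orthogonal_to_vectors[of "span (rows A)" UNIV] by (simp add: row_rank_def)
qed

section \<open>Solutions of the matrix system and the boundary functionals\<close>

lemma solves_system_iff:
  "solves_system A0 A1 B0 B1 Z V X0 X1 \<longleftrightarrow> (\<forall>t\<in>{0..1}.
     ((\<lambda>t. state (Z t) (V t) (X0 t) (X1 t)) has_vector_derivative
       H_matrix A0 A1 B0 B1 *v state (Z t) (V t) (X0 t) (X1 t)) (at t within {0..1}))"
proof -
  have "((\<lambda>t. state (Z t) (V t) (X0 t) (X1 t)) has_vector_derivative state Z' V' X0' X1') (at t within S)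
    \<longleftrightarrow> (Z has_vector_derivative Z') (at t within S) \<and> (V has_vector_derivative V') (at t within S) \<and>
      (X0 has_vector_derivative X0') (at t within S) \<and> (X1 has_vector_derivative X1') (at t within S)"
    (is "?L \<longleftrightarrow> ?R")
    for Z' V' X0' X1' t S
  proof
    assume ?L
    then have "((\<lambda>t. state (Z t) (V t) (X0 t) (X1 t) $ p) has_vector_derivative
        state Z' V' X0' X1' $ p) (at t within S)" for p
      by (rule bounded_linear.has_vector_derivative[OF bounded_linear_vec_nth])
    from this[of "(1, _, _)"] this[of "(2, _, _)"] this[of "(3, _, _)"] this[of "(4, _, _)"] show ?R
      by (auto intro!: has_vector_derivative_vecI)
  next
    assume ?R
    then have *: "((\<lambda>t. Z t $ i $ j) has_vector_derivative Z' $ i $ j) (at t within S)"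
      "((\<lambda>t. V t $ i $ j) has_vector_derivative V' $ i $ j) (at t within S)"
      "((\<lambda>t. X0 t $ i $ j) has_vector_derivative X0' $ i $ j) (at t within S)"
      "((\<lambda>t. X1 t $ i $ j) has_vector_derivative X1' $ i $ j) (at t within S)" for i j
      by (auto intro!: bounded_linear.has_vector_derivative[OF bounded_linear_vec_nth])
    have "((\<lambda>t. state (Z t) (V t) (X0 t) (X1 t) $ (k, i, j)) has_vector_derivative
        state Z' V' X0' X1' $ (k, i, j)) (at t within S)" for k i j
      using * by (cases k rule: exhaust_4[THEN disjE]) auto
    then show ?L
      by (auto intro!: has_vector_derivative_vecI)
  qed
  then show ?thesis
    by (simp add: solves_system_def H_mult_state)
qed


theorem corollary1:
  fixes A0 A1 B0 B1 :: "real^'n^'n"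
  shows "CARD('n)\<^sup>2 \<le> dim {x. M_matrix A0 A1 B0 B1 *v x = 0}
    \<and> dependent_family (\<lambda>i. row i (M_matrix A0 A1 B0 B1))
    \<and> (\<forall>Z0 V0 X00 X10. \<exists>Z V X0 X1. solves_system A0 A1 B0 B1 Z V X0 X1
          \<and> Z 0 = Z0 \<and> V 0 = V0 \<and> X0 0 = X00 \<and> X1 0 = X10)
    \<and> (\<exists>\<phi> :: 3 \<times> 'n \<times> 'n \<Rightarrow>
              ((real^'n^'n) \<times> (real^'n^'n) \<times> (real^'n^'n) \<times> (real^'n^'n)) \<Rightarrow>\<^sub>L real.
          (\<forall>Z V X0 X1. solves_system A0 A1 B0 B1 Z V X0 X1 \<longrightarrow>
             (\<forall>k i j. blinfun_apply (\<phi> (k, i, j)) (Z 0, V 0, X0 0, X1 0)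
                       = boundary_residual Z V X0 X1 $ k $ i $ j))
          \<and> dependent_family \<phi>)"
proof (intro conjI allI)
  let ?H = "H_matrix A0 A1 B0 B1" and ?M = "M_matrix A0 A1 B0 B1"
  show "CARD('n)\<^sup>2 \<le> dim {x. ?M *v x = 0}"
    \<comment> \<open>The rank is at most the number \<open>3 n^2\<close> of rows, while there are
      \<open>4 n^2\<close> columns.\<close>
    using dim_null_space[of ?M] rank_bound[of ?M] by (simp add: power2_eq_square)
  obtain c where c: "c \<noteq> 0" "\<And>w. c \<bullet> (?M *v w) = 0"
    by (rule M_left_null_vector) blast
  then show "dependent_family (\<lambda>i. row i ?M)"
    by (auto simp: dependent_rows_iff)
  \<comment> \<open>Since every initial datum is attained by a solution, the residuals determine the
    functionals \<phi> below uniquely.\<close>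
  show "\<exists>Z V X0 X1. solves_system A0 A1 B0 B1 Z V X0 X1
      \<and> Z 0 = Z0 \<and> V 0 = V0 \<and> X0 0 = X00 \<and> X1 0 = X10" for Z0 V0 X00 X10
  proof -
    define w where "w t = matrix_exp (t *\<^sub>R ?H) *v state Z0 V0 X00 X10" for t
    have "\<forall>t. \<exists>Z V X0 X1. w t = state Z V X0 X1"
      by (metis state_exhaust)
    then obtain Z V X0 X1 where state: "\<And>t. w t = state (Z t) (V t) (X0 t) (X1 t)"
      by metis
    have "solves_system A0 A1 B0 B1 Z V X0 X1"
      unfolding solves_system_iff state[symmetric] w_def
      by (intro ballI matrix_exp_mult_vec_has_vector_derivative)
    moreover have "Z 0 = Z0 \<and> V 0 = V0 \<and> X0 0 = X00 \<and> X1 0 = X10"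
      using state[of 0] by (simp add: w_def state_eq_iff)
    ultimately show ?thesis by blast
  qed
  \<comment> \<open>The last two indices are swapped because \<open>vectorize\<close> puts the
    column index first. The coefficients \<open>d\<close> below are \<open>c\<close> with the same
    swap.\<close>
  define g where "g p x = (case p of (k, i, j) \<Rightarrow> case x of (Z, V, X0, X1) \<Rightarrow>
    (?M *v state Z V X0 X1) $ (k, j, i))" for p :: "3 \<times> 'n \<times> 'n" and x
  have "linear (g p)" for p
    by (simp add: linear_iff g_def state_add[symmetric] state_scaleR[symmetric] mv.add_right
        mv.scaleR_right split: prod.split)
  then have Blinfun_g: "blinfun_apply (Blinfun (g p)) = g p" for p
    by (simp add: bounded_linear_Blinfun_apply linear_linear)
  show "\<exists>\<phi> :: 3 \<times> 'n \<times> 'n \<Rightarrow> _ \<Rightarrow>\<^sub>L real.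
      (\<forall>Z V X0 X1. solves_system A0 A1 B0 B1 Z V X0 X1 \<longrightarrow>
         (\<forall>k i j. blinfun_apply (\<phi> (k, i, j)) (Z 0, V 0, X0 0, X1 0)
                   = boundary_residual Z V X0 X1 $ k $ i $ j))
      \<and> dependent_family \<phi>"
  proof (intro exI[of _ "\<lambda>p. Blinfun (g p)"] conjI allI impI)
    fix Z V X0 X1 and k :: 3 and i j :: 'n
    assume "solves_system A0 A1 B0 B1 Z V X0 X1"
    \<comment> \<open>Uniqueness on the interval expresses the values at time 1 through the initial
      data alone, for an arbitrary solution.\<close>
    then have "matrix_exp ?H *v state (Z 0) (V 0) (X0 0) (X1 0) = state (Z 1) (V 1) (X0 1) (X1 1)"
      using linear_ode_unique[of "{0..1}" 1 "\<lambda>t. state (Z t) (V t) (X0 t) (X1 t)" ?H]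
      by (simp add: solves_system_iff)
    from M_mult_state[OF this]
    show "blinfun_apply (Blinfun (g (k, i, j))) (Z 0, V 0, X0 0, X1 0)
        = boundary_residual Z V X0 X1 $ k $ i $ j"
      using exhaust_3[of k] by (auto simp: Blinfun_g g_def boundary_residual_def vectorize_def)
  next
    define d where "d p = (case p of (k, i, j) \<Rightarrow> c $ (k, j, i))" for p :: "3 \<times> 'n \<times> 'n"
    have "\<exists>p. d p \<noteq> 0"
      using c(1) by (force simp: vec_eq_iff d_def)
    moreover have "(\<Sum>p\<in>UNIV. d p *\<^sub>R Blinfun (g p)) = 0"
    proof (rule blinfun_eqI)
      fix x :: "(real^'n^'n) \<times> (real^'n^'n) \<times> (real^'n^'n) \<times> (real^'n^'n)"
      obtain Z V X0 X1 where x: "x = (Z, V, X0, X1)" by (cases x)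
      let ?m = "?M *v state Z V X0 X1"
      have "(\<Sum>p\<in>UNIV. d p * g p x) = (\<Sum>(k, i, j)\<in>UNIV. c $ (k, j, i) * ?m $ (k, j, i))"
        by (simp add: d_def g_def x case_prod_unfold)
      also have "\<dots> = c \<bullet> ?m"
        unfolding inner_vec_def
        by (rule sum.reindex_bij_witness[of _ "\<lambda>(k, i, j). (k, j, i)" "\<lambda>(k, i, j). (k, j, i)"]) auto
      finally show "blinfun_apply (\<Sum>p\<in>UNIV. d p *\<^sub>R Blinfun (g p)) x = blinfun_apply 0 x"
        using c(2) by (simp add: blinfun.sum_left blinfun.scaleR_left Blinfun_g)
    qed
    ultimately show "dependent_family (\<lambda>p. Blinfun (g p))"
      unfolding dependent_family_def by blast
  qed
qed

end
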